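(* Let $k\geq 2$ be an integer. Every linear hypergraph of rank $r$ with minimum degree at least $k^2-k$ has a $\frac{1}{k}$-majority $(kr+1)$-edge-colouring.
   Context: A hypergraph $H=(V,E)$ consists of a finite vertex set $V$ and a collection $E$ of non-empty subsets of $V$ (hyperedges). The degree $d(v)$ of $v\in V$ is the number of hyperedges containing $v$; the minimum degree is $\min_{v\in V} d(v)$; the rank (maximum edge size) is $r=\max_{e\in E}|e|$. $H$ is linear if $|e_1\cap e_2|\leq 1$ for all distinct $e_1,e_2\in E$. For integers $k\geq 2$ and $m\geq 1$, a $\frac{1}{k}$-majority $m$-edge-colouring of $H$ is a map $c:E\to\{1,\dots,m\}$ such that for every vertex $v$ and every colour $i$, the number of hyperedges $e\ni v$ with $c(e)=i$ is at most $\lfloor d(v)/k\rfloor$. *)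

theory Defs
  imports Main
begin

definition hypergraph :: "'a set \<Rightarrow> 'a set set \<Rightarrow> bool" where
  "hypergraph V E \<longleftrightarrow> finite V \<and> (\<forall>e\<in>E. e \<noteq> {} \<and> e \<subseteq> V)"

definition linear_edges :: "'a set set \<Rightarrow> bool" where
  "linear_edges E \<longleftrightarrow> (\<forall>e1\<in>E. \<forall>e2\<in>E. e1 \<noteq> e2 \<longrightarrow> card (e1 \<inter> e2) \<le> 1)"

definition vertex_degree :: "'a set set \<Rightarrow> 'a \<Rightarrow> nat" where
  "vertex_degree E v = card {e \<in> E. v \<in> e}"

(* Meaningful only for non-empty V, respectively non-empty E, since Min and Max of
   the empty set are unspecified. In a hypergraph with V non-empty and positive
   minimum degree, E is non-empty as well. *)
definition min_degree :: "'a set \<Rightarrow> 'a set set \<Rightarrow> nat" where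
  "min_degree V E = Min (vertex_degree E ` V)"

definition hypergraph_rank :: "'a set set \<Rightarrow> nat" where
  "hypergraph_rank E = Max (card ` E)"

(* Division on nat rounds down, so "vertex_degree E v div k" is the floor of d(v)/k. *)
definition majority_edge_colouring ::
    "nat \<Rightarrow> nat \<Rightarrow> 'a set \<Rightarrow> 'a set set \<Rightarrow> ('a set \<Rightarrow> nat) \<Rightarrow> bool" where
  "majority_edge_colouring k m V E c \<longleftrightarrow>
     c ` E \<subseteq> {1..m} \<and>
     (\<forall>v\<in>V. \<forall>i\<in>{1..m}. card {e \<in> E. v \<in> e \<and> c e = i} \<le> vertex_degree E v div k)"

end

(* Since d(v) is at least k^2 - k, it is at most (k+1) * (d(v) div k), so the edges at v can be
   distributed over d(v) div k groups of size at most k+1. Call two edges in conflict if they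
   lie in a common group at a common vertex. An edge has at most r vertices and hence at most
   k r conflicts, so greedily k r + 1 colours suffice to separate all conflicting edges. Then a
   colour occurs at most once per group, that is, at most d(v) div k times at v. *)
theory Submission
  imports Defs
begin

text \<open>Induction on \<open>A\<close>, extending a colouring by one element: the neighbours of
  \<open>a\<close> that are already coloured use at most \<open>D\<close> of the
  \<open>D + 1\<close> colours, so one colour \<open>i\<close> is free for \<open>a\<close>.\<close>

lemma greedy_colouring:
  fixes R :: "'b \<Rightarrow> 'b \<Rightarrow> bool"
  assumes "finite A"
    and "symp R"
    and "\<And>x. x \<in> A \<Longrightarrow> card {y \<in> A. y \<noteq> x \<and> R x y} \<le> D"
  shows "\<exists>c :: 'b \<Rightarrow> nat. c ` A \<subseteq> {1..D + 1} \<and>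
           (\<forall>x\<in>A. \<forall>y\<in>A. x \<noteq> y \<longrightarrow> R x y \<longrightarrow> c x \<noteq> c y)"
  using assms(1,3)
proof (induction A rule: finite_induct)
  case empty
  then show ?case by simp
next
  case (insert a A)
  have "card {y \<in> A. y \<noteq> x \<and> R x y} \<le> D" if "x \<in> A" for x
  proof -
    have "card {y \<in> A. y \<noteq> x \<and> R x y} \<le> card {y \<in> insert a A. y \<noteq> x \<and> R x y}"
      using insert.hyps(1) by (intro card_mono) auto
    also have "\<dots> \<le> D"
      using insert.prems that by blast
    finally show ?thesis .
  qed
  from insert.IH[OF this] obtain c :: "'b \<Rightarrow> nat" where c: "c ` A \<subseteq> {1..D + 1}"
    "\<forall>x\<in>A. \<forall>y\<in>A. x \<noteq> y \<longrightarrow> R x y \<longrightarrow> c x \<noteq> c y"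
    by blast
  define N where "N = {y \<in> A. R a y}"
  have "N = {y \<in> insert a A. y \<noteq> a \<and> R a y}"
    using insert.hyps(2) by (auto simp: N_def)
  with insert.prems[of a] have "card N \<le> D"
    by simp
  moreover have "card (c ` N) \<le> card N"
    using insert.hyps(1) by (intro card_image_le) (simp add: N_def)
  ultimately have "card (c ` N) < card {1..D + 1}"
    by simp
  then have "\<not> {1..D + 1} \<subseteq> c ` N"
    using insert.hyps(1) card_mono[of "c ` N" "{1..D + 1}"] by (auto simp: N_def)
  then obtain i where i: "i \<in> {1..D + 1}" "i \<notin> c ` N"
    by blast
  \<comment> \<open>\<open>N\<close> only collects the \<open>y\<close> with \<open>R a y\<close>;
    symmetry of \<open>R\<close> covers pairs in which \<open>a\<close> comes second.\<close>
  have new: "i \<noteq> c y" if "y \<in> A" "R a y \<or> R y a" for y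
    using that i(2) sympD[OF assms(2)] by (auto simp: N_def)
  show ?case
  proof (intro exI conjI ballI impI)
    show "(c(a := i)) ` insert a A \<subseteq> {1..D + 1}"
      using c(1) i(1) by auto
    show "(c(a := i)) x \<noteq> (c(a := i)) y"
      if "x \<in> insert a A" "y \<in> insert a A" "x \<noteq> y" "R x y" for x y
      using that c(2) new[of x] new[of y] by auto
  qed
qed

text \<open>Number the elements of \<open>S\<close> from 0 and cut the numbering into consecutive
  blocks of length \<open>n\<close>; the block index \<open>h x div n\<close> serves as
  \<open>g\<close>. For \<open>n = 0\<close> the set \<open>S\<close> is empty.\<close>

lemma ex_partition_bounded_fibres:
  fixes S :: "'b set"
  assumes "finite S" and "card S \<le> q * n"
  shows "\<exists>g :: 'b \<Rightarrow> nat. g ` S \<subseteq> {..<q} \<and> (\<forall>t. card {x \<in> S. g x = t} \<le> n)"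
proof (cases "n = 0")
  case True
  then show ?thesis using assms by auto
next
  case False
  obtain h where h: "bij_betw h S {0..<card S}"
    using ex_bij_betw_finite_nat[OF assms(1)] by blast
  have "h x div n < q" if "x \<in> S" for x
    using bij_betwE[OF h] that assms(2) by (force intro: less_mult_imp_div_less)
  moreover have "card {x \<in> S. h x div n = t} \<le> n" for t
  proof -
    have "h ` {x \<in> S. h x div n = t} \<subseteq> {t * n..<t * n + n}"
      using False by (auto simp: dividend_less_div_times add.commute)
    moreover have "inj_on h {x \<in> S. h x div n = t}"
      using h by (auto simp: bij_betw_def intro: inj_on_subset)
    ultimately have "card {x \<in> S. h x div n = t} \<le> card {t * n..<t * n + n}"
      by (intro card_inj_on_le) auto
    then show ?thesis by simp
  qed
  ultimately show ?thesis
    by (intro exI[of _ "\<lambda>x. h x div n"]) auto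
qed

text \<open>Write d = q k + s with s \<le> k - 1. The lower bound (k - 1) k on d forces q \<ge> k -
  1 \<ge> s, hence d \<le> q k + q. This is where the minimum degree condition enters.\<close>

lemma le_div_mult_Suc:
  fixes d k :: nat
  assumes "k > 0" and "k\<^sup>2 - k \<le> d"
  shows "d \<le> d div k * (k + 1)"
proof -
  have "(k - 1) * k \<le> d"
    using assms(2) by (simp add: power2_eq_square diff_mult_distrib)
  then have "k - 1 \<le> d div k"
    using assms(1) by (simp add: less_eq_div_iff_mult_less_eq)
  moreover have "d mod k \<le> k - 1"
    using assms(1) mod_less_divisor[of k d] by linarith
  moreover have "d = d div k * k + d mod k"
    by simp
  ultimately show ?thesis
    by (simp only: distrib_left)
qed

theorem theorem3:
  fixes k r :: nat and V :: "'a set" and E :: "'a set set"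
  assumes "k \<ge> 2"
    and "hypergraph V E"
    and "linear_edges E"
    and "hypergraph_rank E = r"
    and "min_degree V E \<ge> k^2 - k"
  shows "\<exists>c. majority_edge_colouring k (k * r + 1) V E c"
proof -
  have V: "finite V" and EV: "\<And>e. e \<in> E \<Longrightarrow> e \<subseteq> V"
    using assms(2) by (auto simp: hypergraph_def)
  have E: "finite E"
    using V EV by (intro finite_subset[of E "Pow V"]) auto
  have rank: "card e \<le> r" if "e \<in> E" for e
    using that E assms(4) by (auto simp: hypergraph_rank_def)
  define S where "S v = {e \<in> E. v \<in> e}" for v
  have S: "finite (S v)" for v
    using E by (simp add: S_def)
  have "\<exists>g :: 'a set \<Rightarrow> nat. g ` S v \<subseteq> {..<vertex_degree E v div k} \<and>
          (\<forall>t. card {e \<in> S v. g e = t} \<le> k + 1)" if "v \<in> V" for v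
  proof (rule ex_partition_bounded_fibres[OF S])
    have "k\<^sup>2 - k \<le> vertex_degree E v"
      using assms(5) V that by (auto simp: min_degree_def intro: order_trans[OF _ Min_le])
    then show "card (S v) \<le> vertex_degree E v div k * (k + 1)"
      using le_div_mult_Suc[of k "vertex_degree E v"] assms(1)
      by (simp add: S_def vertex_degree_def)
  qed
  \<comment> \<open>The groupings at different vertices are chosen independently, so an edge carries
    a separate group index \<open>g v e\<close> for each of its vertices \<open>v\<close>.\<close>
  then obtain g :: "'a \<Rightarrow> 'a set \<Rightarrow> nat" where
    g: "\<And>v. v \<in> V \<Longrightarrow> g v ` S v \<subseteq> {..<vertex_degree E v div k}"
       "\<And>v t. v \<in> V \<Longrightarrow> card {e \<in> S v. g v e = t} \<le> k + 1"
    by metis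
  define R where "R e f \<longleftrightarrow> (\<exists>v \<in> e \<inter> f. g v e = g v f)" for e f
  have "card {f \<in> E. f \<noteq> e \<and> R e f} \<le> k * r" if e: "e \<in> E" for e
  proof -
    have "card {f \<in> E. f \<noteq> e \<and> R e f} \<le> card (\<Union>v\<in>e. {f \<in> S v. g v f = g v e} - {e})"
      using E EV[OF e] finite_subset[OF _ V] by (intro card_mono) (auto simp: R_def S_def)
    also have "\<dots> \<le> (\<Sum>v\<in>e. card ({f \<in> S v. g v f = g v e} - {e}))"
      using EV[OF e] finite_subset[OF _ V] by (intro card_UN_le) auto
    also have "\<dots> \<le> (\<Sum>v\<in>e. k)"
    proof (rule sum_mono)
      fix v assume v: "v \<in> e"
      \<comment> \<open>The edge \<open>e\<close> lies in its own group at \<open>v\<close>, so of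
        the at most k + 1 members only k can conflict with it there.\<close>
      have "card ({f \<in> S v. g v f = g v e} - {e}) = card {f \<in> S v. g v f = g v e} - 1"
        using v e by (intro card_Diff_singleton) (simp add: S_def)
      also have "\<dots> \<le> k"
        using g(2)[of v "g v e"] EV[OF e] v by auto
      finally show "card ({f \<in> S v. g v f = g v e} - {e}) \<le> k" .
    qed
    also have "\<dots> \<le> k * r"
      using rank[OF e] by simp
    finally show ?thesis .
  qed
  moreover have "symp R"
    unfolding R_def symp_def by (metis Int_commute)
  ultimately obtain c :: "'a set \<Rightarrow> nat" where c: "c ` E \<subseteq> {1..k * r + 1}"
    "\<forall>e\<in>E. \<forall>f\<in>E. e \<noteq> f \<longrightarrow> R e f \<longrightarrow> c e \<noteq> c f"
    using greedy_colouring[OF E, of R "k * r"] by blast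
  have "card {e \<in> E. v \<in> e \<and> c e = i} \<le> vertex_degree E v div k" if v: "v \<in> V" for v i
  proof -
    \<comment> \<open>Two distinct edges at \<open>v\<close> with equal group index are related by
      \<open>R\<close> through \<open>v\<close>, hence differ in colour. So \<open>g v\<close>
      embeds each colour class at \<open>v\<close> into the set of group indices.\<close>
    have "inj_on (g v) {e \<in> E. v \<in> e \<and> c e = i}"
      using c(2) unfolding inj_on_def R_def by blast
    moreover have "g v ` {e \<in> E. v \<in> e \<and> c e = i} \<subseteq> {..<vertex_degree E v div k}"
      using g(1)[OF v] by (auto simp: S_def)
    ultimately show ?thesis
      using card_inj_on_le[OF _ _ finite_lessThan] by fastforce
  qed
  with c(1) show ?thesis
    unfolding majority_edge_colouring_def by blast
qed

end
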